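(* Let $(X,\mathsf d)$ be a complete separable metric space and $\mu$ a Borel probability measure on $X$ with $\int_X \mathsf d^4(x_0,y)\,d\mu(y)<\infty$ for some $x_0\in X$. Let $T$ be the associated centered operator on $L^2(X,\mu)$ (see context), let $\{u_i\}_{i\ge1}$ be an orthonormal basis of $L^2(X,\mu)$ consisting of eigenfunctions of $T$, and let $\lambda_i$ be the eigenvalue corresponding to $u_i$. Assume that $T$ is trace-class, i.e. $\sum_i|\lambda_i|<+\infty$, and that $\mu$-a.e. point $x\in X$ is a Lebesgue point of the function $f:=\sum_{i=1}^\infty|\lambda_i|u_i^2\in L^1(X,\mu)$. Then \[ \sum_{i=1}^\infty\lambda_i\,(u_i(x)-u_i(y))^2=\mathsf d^2(x,y)\qquad\text{for }\mu\otimes\mu\text{-a.e. }(x,y)\in X\times X. \]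
   Context: Set $\mathsf k(x,y):=-\tfrac12\mathsf d^2(x,y)$ and $(Kg)(x):=\int_X\mathsf k(x,y)g(y)\,d\mu(y)$ on $L^2(X,\mu)$. Let $Pg:=g-\int_X g\,d\mu$ be the orthogonal projector onto the orthogonal complement of the constants, and $T:=PKP$. Under the fourth moment condition $T$ is a self-adjoint Hilbert--Schmidt operator, namely the integral operator with kernel \[ \mathsf k_T(x,y)=\mathsf k(x,y)-\int_X\mathsf k(x,y')\,d\mu(y')-\int_X\mathsf k(x',y)\,d\mu(x')+\int_X\int_X\mathsf k(x',y')\,d\mu(x')\,d\mu(y'). \] An eigenfunction $u$ with eigenvalue $\lambda\ne0$ is identified with its continuous representative $u(x)=\lambda^{-1}\int_X\mathsf k_T(x,y)u(y)\,d\mu(y)$, $x\in X$; terms with $\lambda_i=0$ are zero in the sums, so $f$ is defined pointwise with values in $[0,+\infty]$. A point $x$ is a Lebesgue point of $f$ if $f(x)<\infty$, $\mu(B_r(x))>0$ for all $r>0$, and $\lim_{r\to0}\frac1{\mu(B_r(x))}\int_{B_r(x)}|f-f(x)|\,d\mu=0$, where $B_r(x)$ is the open ball. *)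

theory Defs
  imports "HOL-Probability.Probability"
begin

definition sqdist_kernel :: "'a::metric_space \<Rightarrow> 'a \<Rightarrow> real" where
  "sqdist_kernel x y = - (1/2) * (dist x y)\<^sup>2"

text \<open>Elements of \<open>L\<^sup>2(X, \<mu>)\<close> are represented by functions; equality in \<open>L\<^sup>2\<close> is equality
  almost everywhere.\<close>

definition L2_functions :: "'a measure \<Rightarrow> ('a \<Rightarrow> real) set" where
  "L2_functions \<mu> = {g \<in> borel_measurable \<mu>. integrable \<mu> (\<lambda>x. (g x)\<^sup>2)}"

definition K_op :: "'a::metric_space measure \<Rightarrow> ('a \<Rightarrow> real) \<Rightarrow> 'a \<Rightarrow> real" where
  "K_op \<mu> g = (\<lambda>x. \<integral>y. sqdist_kernel x y * g y \<partial>\<mu>)"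

definition P_op :: "'a measure \<Rightarrow> ('a \<Rightarrow> real) \<Rightarrow> 'a \<Rightarrow> real" where
  "P_op \<mu> g = (\<lambda>x. g x - (\<integral>y. g y \<partial>\<mu>))"

definition T_op :: "'a::metric_space measure \<Rightarrow> ('a \<Rightarrow> real) \<Rightarrow> 'a \<Rightarrow> real" where
  "T_op \<mu> g = P_op \<mu> (K_op \<mu> (P_op \<mu> g))"

definition T_kernel :: "'a::metric_space measure \<Rightarrow> 'a \<Rightarrow> 'a \<Rightarrow> real" where
  "T_kernel \<mu> x y =
     sqdist_kernel x y
     - (\<integral>y'. sqdist_kernel x y' \<partial>\<mu>)
     - (\<integral>x'. sqdist_kernel x' y \<partial>\<mu>)
     + (\<integral>y'. (\<integral>x'. sqdist_kernel x' y' \<partial>\<mu>) \<partial>\<mu>)"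

definition T_eigenfunction :: "'a::metric_space measure \<Rightarrow> real \<Rightarrow> ('a \<Rightarrow> real) \<Rightarrow> bool" where
  "T_eigenfunction \<mu> l u \<longleftrightarrow>
     u \<in> L2_functions \<mu> \<and> \<not> (AE x in \<mu>. u x = 0) \<and> (AE x in \<mu>. T_op \<mu> u x = l * u x)"

text \<open>The continuous representative of an eigenfunction with eigenvalue \<open>l \<noteq> 0\<close>. For \<open>l = 0\<close> the
  value is the dummy \<open>0\<close>; it is only ever used multiplied by \<open>l\<close>.\<close>

definition continuous_rep :: "'a::metric_space measure \<Rightarrow> real \<Rightarrow> ('a \<Rightarrow> real) \<Rightarrow> 'a \<Rightarrow> real" where
  "continuous_rep \<mu> l u x = inverse l * (\<integral>y. T_kernel \<mu> x y * u y \<partial>\<mu>)"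

text \<open>Orthonormal families whose finite linear combinations are dense in \<open>L\<^sup>2(X, \<mu>)\<close>. The index
  set is an arbitrary set of natural numbers because \<open>L\<^sup>2(X, \<mu>)\<close> is finite-dimensional when
  \<open>\<mu>\<close> is finitely supported.\<close>

definition L2_orthonormal_basis :: "'a measure \<Rightarrow> nat set \<Rightarrow> (nat \<Rightarrow> 'a \<Rightarrow> real) \<Rightarrow> bool" where
  "L2_orthonormal_basis \<mu> I u \<longleftrightarrow>
     (\<forall>i\<in>I. u i \<in> L2_functions \<mu>) \<and>
     (\<forall>i\<in>I. \<forall>j\<in>I. (\<integral>x. u i x * u j x \<partial>\<mu>) = (if i = j then 1 else 0)) \<and>
     (\<forall>g\<in>L2_functions \<mu>. \<forall>e>0. \<exists>F c. finite F \<and> F \<subseteq> I \<and>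
        sqrt (\<integral>x. (g x - (\<Sum>i\<in>F. c i * u i x))\<^sup>2 \<partial>\<mu>) < e)"

text \<open>The absolute value \<open>\<bar>f y - f x\<bar>\<close> is taken in the extended reals, since subtraction of
  extended nonnegative reals truncates at \<open>0\<close>; it is \<open>\<infinity>\<close> where \<open>f y = \<infinity>\<close>.\<close>

definition Lebesgue_point :: "'a::metric_space measure \<Rightarrow> ('a \<Rightarrow> ennreal) \<Rightarrow> 'a \<Rightarrow> bool" where
  "Lebesgue_point \<mu> f x \<longleftrightarrow>
     f x < \<infinity> \<and>
     (\<forall>r>0. emeasure \<mu> (ball x r) > 0) \<and>
     ((\<lambda>r. (\<integral>\<^sup>+y\<in>ball x r. e2ennreal \<bar>enn2ereal (f y) - enn2ereal (f x)\<bar> \<partial>\<mu>)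
             / emeasure \<mu> (ball x r)) \<longlongrightarrow> 0) (at_right 0)"

end

theory Submission
  imports Defs
begin

text \<open>For almost every \<open>x\<close> one has \<open>\<langle>k\<^sub>T(x, \<cdot>), u\<^sub>i\<rangle> = \<lambda>\<^sub>i u\<^sub>i(x)\<close> for all \<open>i\<close> (also when
  \<open>\<lambda>\<^sub>i = 0\<close>), so Parseval's identity for \<open>k\<^sub>T(x, \<cdot>)\<close> and the normalised indicator of \<open>B\<^sub>r(y)\<close>
  expresses the average of \<open>k\<^sub>T(x, \<cdot>)\<close> over \<open>B\<^sub>r(y)\<close> as the sum of \<open>\<lambda>\<^sub>i u\<^sub>i(x)\<close> times the average of
  \<open>u\<^sub>i\<close>. The terms are dominated by \<open>|\<lambda>\<^sub>i|/2\<close> times \<open>u\<^sub>i(x)\<^sup>2\<close> plus the average of \<open>u\<^sub>i\<^sup>2\<close>; if \<open>y\<close>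
  is a Lebesgue point of \<open>f\<close>, these bounds converge termwise and their sums converge to
  \<open>(f(x) + f(y))/2\<close>. A generalised dominated convergence theorem then gives
  \<open>k\<^sub>T(x, y) = \<Sum>\<^sub>i \<lambda>\<^sub>i u\<^sub>i(x) u\<^sub>i(y)\<close> as \<open>r \<rightarrow> 0\<close>, where \<open>y = x\<close> is allowed, and the claim follows from
  \<open>d\<^sup>2(x, y) = k\<^sub>T(x, x) + k\<^sub>T(y, y) - 2 k\<^sub>T(x, y)\<close>.\<close>

section \<open>Products and linear combinations of square-integrable functions\<close>

lemma L2_integrable_mult:
  assumes "g \<in> L2_functions M" "h \<in> L2_functions M"
  shows "integrable M (\<lambda>x. g x * h x)"
proof (rule Bochner_Integration.integrable_bound)
  show "integrable M (\<lambda>x. (g x)\<^sup>2 + (h x)\<^sup>2)"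
    using assms by (auto simp: L2_functions_def)
  show "(\<lambda>x. g x * h x) \<in> borel_measurable M"
    using assms by (auto simp: L2_functions_def)
  have "\<bar>a * b\<bar> \<le> \<bar>a\<^sup>2 + b\<^sup>2\<bar>" for a b :: real
  proof -
    have "2 * \<bar>a\<bar> * \<bar>b\<bar> \<le> a\<^sup>2 + b\<^sup>2"
      using sum_squares_bound[of "\<bar>a\<bar>" "\<bar>b\<bar>"] by simp
    moreover have "0 \<le> \<bar>a\<bar> * \<bar>b\<bar>" by simp
    ultimately show ?thesis unfolding abs_mult by linarith
  qed
  then show "AE x in M. norm (g x * h x) \<le> norm ((g x)\<^sup>2 + (h x)\<^sup>2)" by simp
qed

lemma L2_add:
  assumes "g \<in> L2_functions M" "h \<in> L2_functions M"
  shows "(\<lambda>x. g x + h x) \<in> L2_functions M"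
  using assms integrable_mult_right[OF L2_integrable_mult[OF assms], of 2]
  by (auto simp: L2_functions_def power2_sum mult.assoc)

lemma L2_cmult: "g \<in> L2_functions M \<Longrightarrow> (\<lambda>x. c * g x) \<in> L2_functions M"
  by (auto simp: L2_functions_def power_mult_distrib)

lemma L2_diff:
  assumes "g \<in> L2_functions M" "h \<in> L2_functions M"
  shows "(\<lambda>x. g x - h x) \<in> L2_functions M"
  using L2_add[OF assms(1) L2_cmult[OF assms(2), of "-1"]] by simp

lemma L2_sum:
  assumes "\<And>i. i \<in> F \<Longrightarrow> g i \<in> L2_functions M"
  shows "(\<lambda>x. \<Sum>i\<in>F. g i x) \<in> L2_functions M"
  using assms
proof (induction F rule: infinite_finite_induct)
  case (insert i F)
  then show ?case by (auto intro: L2_add)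
qed (auto simp: L2_functions_def)

lemma L2_bound:
  assumes "h \<in> L2_functions M" "g \<in> borel_measurable M" "\<And>x. \<bar>g x\<bar> \<le> \<bar>h x\<bar>"
  shows "g \<in> L2_functions M"
proof -
  have "integrable M (\<lambda>x. (g x)\<^sup>2)"
  proof (rule Bochner_Integration.integrable_bound)
    show "integrable M (\<lambda>x. (h x)\<^sup>2)" using assms by (auto simp: L2_functions_def)
    show "AE x in M. norm ((g x)\<^sup>2) \<le> norm ((h x)\<^sup>2)"
      using assms(3) by (simp add: abs_le_square_iff)
  qed (use assms in auto)
  then show ?thesis using assms by (auto simp: L2_functions_def)
qed

lemma (in finite_measure) L2_const: "(\<lambda>_. c) \<in> L2_functions M"
  by (auto simp: L2_functions_def)

lemma (in finite_measure) L2_integrable: "g \<in> L2_functions M \<Longrightarrow> integrable M g"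
  using L2_integrable_mult[of g M "\<lambda>_. 1"] L2_const[of 1] by simp

lemma (in finite_measure) L2_indicator:
  "B \<in> sets M \<Longrightarrow> indicator B \<in> L2_functions M"
  by (rule L2_bound[OF L2_const[of 1]]) (auto simp: indicator_def)

section \<open>Bessel's inequality and Parseval's identity\<close>

text \<open>Expanding the square and using orthonormality, then completing the square in each
  \<open>c i\<close>. The last sum isolates the dependence on \<open>c\<close> and vanishes for the
  Fourier coefficients, so one identity yields both Bessel's inequality and the optimality of these
  coefficients.\<close>

lemma L2_approximation_error:
  assumes onb: "L2_orthonormal_basis M I u" and F: "finite F" "F \<subseteq> I"
    and g: "g \<in> L2_functions M"
  shows "(\<integral>x. (g x - (\<Sum>i\<in>F. c i * u i x))\<^sup>2 \<partial>M) =
    (\<integral>x. (g x)\<^sup>2 \<partial>M) - (\<Sum>i\<in>F. (\<integral>x. g x * u i x \<partial>M)\<^sup>2)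
      + (\<Sum>i\<in>F. (c i - (\<integral>x. g x * u i x \<partial>M))\<^sup>2)"
proof -
  define s where "s = (\<lambda>x. \<Sum>i\<in>F. c i * u i x)"
  have u: "u i \<in> L2_functions M" if "i \<in> F" for i
    using onb F that by (auto simp: L2_orthonormal_basis_def)
  have orth: "(\<integral>x. u i x * u j x \<partial>M) = (if i = j then 1 else 0)" if "i \<in> F" "j \<in> F" for i j
    using onb F that unfolding L2_orthonormal_basis_def by blast
  have s: "s \<in> L2_functions M"
    unfolding s_def by (intro L2_sum L2_cmult u)
  have gs: "(\<integral>x. g x * s x \<partial>M) = (\<Sum>i\<in>F. c i * (\<integral>x. g x * u i x \<partial>M))"
  proof -
    have "(\<integral>x. g x * s x \<partial>M) = (\<integral>x. (\<Sum>i\<in>F. c i * (g x * u i x)) \<partial>M)"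
      unfolding s_def by (simp add: sum_distrib_left algebra_simps)
    also have "\<dots> = (\<Sum>i\<in>F. c i * (\<integral>x. g x * u i x \<partial>M))"
      using L2_integrable_mult[OF g u] by (subst Bochner_Integration.integral_sum) auto
    finally show ?thesis .
  qed
  have us: "(\<integral>x. u j x * s x \<partial>M) = c j" if "j \<in> F" for j
  proof -
    have "(\<integral>x. u j x * s x \<partial>M) = (\<integral>x. (\<Sum>i\<in>F. c i * (u j x * u i x)) \<partial>M)"
      unfolding s_def by (simp add: sum_distrib_left algebra_simps)
    also have "\<dots> = (\<Sum>i\<in>F. c i * (\<integral>x. u j x * u i x \<partial>M))"
      using L2_integrable_mult[OF u[OF that] u] by (subst Bochner_Integration.integral_sum) auto
    also have "\<dots> = (\<Sum>i\<in>F. if j = i then c i else 0)"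
      using orth[OF that] by (intro sum.cong) auto
    also have "\<dots> = c j"
      using F that by simp
    finally show ?thesis .
  qed
  have ss: "(\<integral>x. s x * s x \<partial>M) = (\<Sum>i\<in>F. (c i)\<^sup>2)"
  proof -
    have "s x * s x = (\<Sum>i\<in>F. c i * (u i x * s x))" for x
    proof -
      have "s x * s x = (\<Sum>i\<in>F. c i * u i x) * s x" by (simp only: s_def)
      then show ?thesis by (simp add: sum_distrib_right mult.assoc)
    qed
    then have "(\<integral>x. s x * s x \<partial>M) = (\<integral>x. (\<Sum>i\<in>F. c i * (u i x * s x)) \<partial>M)"
      by simp
    also have "\<dots> = (\<Sum>i\<in>F. c i * (\<integral>x. u i x * s x \<partial>M))"
      using L2_integrable_mult[OF u s] by (subst Bochner_Integration.integral_sum) auto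
    finally show ?thesis using us by (simp add: power2_eq_square)
  qed
  have "(\<integral>x. (g x - s x)\<^sup>2 \<partial>M) = (\<integral>x. g x * g x - 2 * (g x * s x) + s x * s x \<partial>M)"
    by (simp add: power2_eq_square algebra_simps)
  also have "\<dots> = (\<integral>x. g x * g x \<partial>M) - 2 * (\<integral>x. g x * s x \<partial>M) + (\<integral>x. s x * s x \<partial>M)"
    using L2_integrable_mult[OF g g] L2_integrable_mult[OF g s] L2_integrable_mult[OF s s] by simp
  finally have error: "(\<integral>x. (g x - s x)\<^sup>2 \<partial>M) = (\<integral>x. g x * g x \<partial>M)
      - 2 * (\<Sum>i\<in>F. c i * (\<integral>x. g x * u i x \<partial>M)) + (\<Sum>i\<in>F. (c i)\<^sup>2)"
    unfolding gs ss .
  moreover have "(\<Sum>i\<in>F. (c i - (\<integral>x. g x * u i x \<partial>M))\<^sup>2) = (\<Sum>i\<in>F. (c i)\<^sup>2)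
      - 2 * (\<Sum>i\<in>F. c i * (\<integral>x. g x * u i x \<partial>M)) + (\<Sum>i\<in>F. (\<integral>x. g x * u i x \<partial>M)\<^sup>2)"
    by (simp add: power2_diff sum.distrib sum_subtractf sum_distrib_left mult.assoc)
  ultimately show ?thesis
    by (simp add: s_def power2_eq_square)
qed

text \<open>Density provides a finite \<open>F\<close> whose Fourier coefficients capture all but
  \<open>e\<close> of the squared norm; enlarging \<open>F\<close> only increases the partial sum,
  and Bessel's inequality caps it.\<close>

lemma L2_Parseval:
  assumes onb: "L2_orthonormal_basis M I u" and g: "g \<in> L2_functions M"
  shows "((\<lambda>i. (\<integral>x. g x * u i x \<partial>M)\<^sup>2) has_sum (\<integral>x. (g x)\<^sup>2 \<partial>M)) I"
  unfolding has_sum_def tendsto_iff eventually_finite_subsets_at_top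
proof (intro allI impI)
  fix e :: real assume e: "e > 0"
  let ?\<gamma> = "\<lambda>i. \<integral>x. g x * u i x \<partial>M"
  have "\<forall>g\<in>L2_functions M. \<forall>e>0. \<exists>F c. finite F \<and> F \<subseteq> I \<and>
      sqrt (\<integral>x. (g x - (\<Sum>i\<in>F. c i * u i x))\<^sup>2 \<partial>M) < e"
    using onb by (simp add: L2_orthonormal_basis_def)
  \<comment> \<open>The basis property speaks of norms, so the tolerance \<open>sqrt e\<close> makes
    the squared error less than \<open>e\<close>.\<close>
  from this[rule_format, OF g, of "sqrt e"] e obtain F c where F: "finite F" "F \<subseteq> I"
    and "sqrt (\<integral>x. (g x - (\<Sum>i\<in>F. c i * u i x))\<^sup>2 \<partial>M) < sqrt e"
    by auto
  then have "(\<integral>x. (g x)\<^sup>2 \<partial>M) - (\<Sum>i\<in>F. (?\<gamma> i)\<^sup>2) + (\<Sum>i\<in>F. (c i - ?\<gamma> i)\<^sup>2) < e"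
    using L2_approximation_error[OF onb F g, of c] by simp
  moreover have "0 \<le> (\<Sum>i\<in>F. (c i - ?\<gamma> i)\<^sup>2)" by (simp add: sum_nonneg)
  ultimately have less: "(\<integral>x. (g x)\<^sup>2 \<partial>M) - (\<Sum>i\<in>F. (?\<gamma> i)\<^sup>2) < e" by linarith
  show "\<exists>X. finite X \<and> X \<subseteq> I \<and>
      (\<forall>Y. finite Y \<and> X \<subseteq> Y \<and> Y \<subseteq> I \<longrightarrow> dist (\<Sum>i\<in>Y. (?\<gamma> i)\<^sup>2) (\<integral>x. (g x)\<^sup>2 \<partial>M) < e)"
  proof (intro exI[of _ F] conjI allI impI F)
    fix Y assume Y: "finite Y \<and> F \<subseteq> Y \<and> Y \<subseteq> I"
    \<comment> \<open>Bessel's inequality for \<open>Y\<close>: the error formula with the Fourier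
      coefficients themselves as \<open>c\<close>.\<close>
    have "0 \<le> (\<integral>x. (g x - (\<Sum>i\<in>Y. ?\<gamma> i * u i x))\<^sup>2 \<partial>M)" by simp
    then have "(\<Sum>i\<in>Y. (?\<gamma> i)\<^sup>2) \<le> (\<integral>x. (g x)\<^sup>2 \<partial>M)"
      using L2_approximation_error[OF onb _ _ g, of Y ?\<gamma>] Y by simp
    moreover have "(\<Sum>i\<in>F. (?\<gamma> i)\<^sup>2) \<le> (\<Sum>i\<in>Y. (?\<gamma> i)\<^sup>2)"
      using Y by (intro sum_mono2) auto
    ultimately show "dist (\<Sum>i\<in>Y. (?\<gamma> i)\<^sup>2) (\<integral>x. (g x)\<^sup>2 \<partial>M) < e"
      using less by (simp add: dist_real_def)
  qed
qed

text \<open>Polarization of \<open>L2_Parseval\<close>, applied to \<open>g + h\<close> and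
  \<open>g - h\<close>.\<close>

lemma L2_Parseval_inner:
  assumes onb: "L2_orthonormal_basis M I u"
    and g: "g \<in> L2_functions M" and h: "h \<in> L2_functions M"
  shows "((\<lambda>i. (\<integral>x. g x * u i x \<partial>M) * (\<integral>x. h x * u i x \<partial>M)) has_sum (\<integral>x. g x * h x \<partial>M)) I"
proof -
  let ?a = "\<lambda>i. \<integral>x. g x * u i x \<partial>M" and ?b = "\<lambda>i. \<integral>x. h x * u i x \<partial>M"
  let ?p = "\<lambda>x. g x + h x" and ?q = "\<lambda>x. g x - h x"
  have sum: "((\<lambda>i. 1/4 * (\<integral>x. ?p x * u i x \<partial>M)\<^sup>2 + (-1/4) * (\<integral>x. ?q x * u i x \<partial>M)\<^sup>2) has_sum
      1/4 * (\<integral>x. (?p x)\<^sup>2 \<partial>M) + (-1/4) * (\<integral>x. (?q x)\<^sup>2 \<partial>M)) I"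
    by (intro has_sum_cmult_right has_sum_add L2_Parseval[OF onb] L2_add L2_diff g h)
  have eq: "1/4 * (\<integral>x. (?p x)\<^sup>2 \<partial>M) + (-1/4) * (\<integral>x. (?q x)\<^sup>2 \<partial>M) = (\<integral>x. g x * h x \<partial>M)"
  proof -
    have "(\<integral>x. (?p x)\<^sup>2 \<partial>M) - (\<integral>x. (?q x)\<^sup>2 \<partial>M) = (\<integral>x. (?p x)\<^sup>2 - (?q x)\<^sup>2 \<partial>M)"
      using L2_add[OF g h] L2_diff[OF g h] by (simp add: L2_functions_def)
    also have "\<dots> = (\<integral>x. 4 * (g x * h x) \<partial>M)"
      by (rule Bochner_Integration.integral_cong) (auto simp: power2_eq_square algebra_simps)
    finally show ?thesis by simp
  qed
  have terms: "1/4 * (\<integral>x. ?p x * u i x \<partial>M)\<^sup>2 + (-1/4) * (\<integral>x. ?q x * u i x \<partial>M)\<^sup>2 = ?a i * ?b i"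
    if "i \<in> I" for i
  proof -
    have u: "u i \<in> L2_functions M" using onb that by (auto simp: L2_orthonormal_basis_def)
    have eqs: "(\<integral>x. ?p x * u i x \<partial>M) = ?a i + ?b i" "(\<integral>x. ?q x * u i x \<partial>M) = ?a i - ?b i"
      using L2_integrable_mult[OF g u] L2_integrable_mult[OF h u]
      by (simp_all add: distrib_right left_diff_distrib)
    show ?thesis unfolding eqs by (simp add: power2_eq_square field_simps)
  qed
  show ?thesis
    by (rule iffD1[OF has_sum_cong sum[unfolded eq]]) (rule terms)
qed

section \<open>Unconditional sums: dominated limits and extended nonnegative values\<close>

text \<open>Since \<open>b\<close> dominates \<open>a\<close>, every tail of the sum of \<open>a r\<close> is bounded by \<open>B r\<close> minus a partial sum
  of \<open>b r\<close>, and this estimate passes to the limit.\<close>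

lemma has_sum_dominated_tendsto:
  fixes a :: "'b \<Rightarrow> 'i \<Rightarrow> real"
  assumes "H \<noteq> bot"
    and a: "\<forall>\<^sub>F r in H. (a r has_sum S r) I"
    and dom: "\<forall>\<^sub>F r in H. \<forall>i\<in>I. \<bar>a r i\<bar> \<le> b r i"
    and b: "\<forall>\<^sub>F r in H. \<forall>F. finite F \<longrightarrow> F \<subseteq> I \<longrightarrow> sum (b r) F \<le> B r"
    and a_lim: "\<And>i. i \<in> I \<Longrightarrow> ((\<lambda>r. a r i) \<longlongrightarrow> a' i) H"
    and b_lim: "\<And>i. i \<in> I \<Longrightarrow> ((\<lambda>r. b r i) \<longlongrightarrow> b' i) H"
    and S: "(S \<longlongrightarrow> S') H" and B: "(B \<longlongrightarrow> B') H"
    and b': "(b' has_sum B') I"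
  shows "(a' has_sum S') I"
proof -
  have tail: "\<bar>sum a' F - S'\<bar> \<le> B' - sum b' F" if F: "finite F" "F \<subseteq> I" for F
  proof (rule tendsto_le[OF \<open>H \<noteq> bot\<close>])
    show "((\<lambda>r. B r - sum (b r) F) \<longlongrightarrow> B' - sum b' F) H"
      using F by (intro tendsto_intros B b_lim) auto
    show "((\<lambda>r. \<bar>sum (a r) F - S r\<bar>) \<longlongrightarrow> \<bar>sum a' F - S'\<bar>) H"
      using F by (intro tendsto_intros S a_lim) auto
    show "\<forall>\<^sub>F r in H. \<bar>sum (a r) F - S r\<bar> \<le> B r - sum (b r) F"
      using a dom b
    proof eventually_elim
      case (elim r)
      \<comment> \<open>For fixed \<open>r\<close>, the tail is first estimated on finite sets
        \<open>G\<close> containing \<open>F\<close>; letting \<open>G\<close> grow to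
        \<open>I\<close> replaces \<open>sum (a r) G\<close> by \<open>S r\<close>.\<close>
      have "((\<lambda>G. \<bar>sum (a r) F - sum (a r) G\<bar>) \<longlongrightarrow> \<bar>sum (a r) F - S r\<bar>) (finite_subsets_at_top I)"
        using elim(1) unfolding has_sum_def by (intro tendsto_intros)
      moreover have "\<forall>\<^sub>F G in finite_subsets_at_top I.
          \<bar>sum (a r) F - sum (a r) G\<bar> \<le> B r - sum (b r) F"
        unfolding eventually_finite_subsets_at_top
      proof (intro exI[of _ F] conjI allI impI F)
        fix G assume G: "finite G \<and> F \<subseteq> G \<and> G \<subseteq> I"
        have "\<bar>sum (a r) F - sum (a r) G\<bar> = \<bar>sum (a r) (G - F)\<bar>"
          using G by (simp add: sum_diff)
        also have "\<dots> \<le> (\<Sum>i\<in>G - F. \<bar>a r i\<bar>)" by (rule sum_abs)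
        also have "\<dots> \<le> sum (b r) (G - F)" using elim(2) G by (intro sum_mono) auto
        also have "\<dots> = sum (b r) G - sum (b r) F" using G by (simp add: sum_diff)
        also have "\<dots> \<le> B r - sum (b r) F" using elim(3) G by simp
        finally show "\<bar>sum (a r) F - sum (a r) G\<bar> \<le> B r - sum (b r) F" .
      qed
      ultimately show ?case
        by (rule tendsto_upperbound) simp
    qed
  qed
  \<comment> \<open>The tail bound tends to zero exactly because \<open>b'\<close> sums to the limit
    \<open>B'\<close> of the majorants, so no mass of the majorant escapes in the limit.\<close>
  have "((\<lambda>F. sum a' F - S') \<longlongrightarrow> 0) (finite_subsets_at_top I)"
  proof (rule Lim_null_comparison)
    show "\<forall>\<^sub>F F in finite_subsets_at_top I. norm (sum a' F - S') \<le> B' - sum b' F"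
      using eventually_finite_subsets_at_top_weakI[of I] tail by simp
    have "((\<lambda>F. B' - sum b' F) \<longlongrightarrow> B' - B') (finite_subsets_at_top I)"
      using b' unfolding has_sum_def by (intro tendsto_intros)
    then show "((\<lambda>F. B' - sum b' F) \<longlongrightarrow> 0) (finite_subsets_at_top I)" by simp
  qed
  then show ?thesis unfolding has_sum_def by (subst LIM_zero_iff[symmetric])
qed

text \<open>Converts finiteness of \<open>f\<close> at a point into real summability: the finite
  value bounds all partial sums, and both kinds of sum are the supremum of these.\<close>

lemma has_sum_enn2real_infsum:
  fixes g :: "'i \<Rightarrow> real"
  assumes nonneg: "\<And>i. i \<in> I \<Longrightarrow> 0 \<le> g i" and fin: "(\<Sum>\<^sub>\<infinity>i\<in>I. ennreal (g i)) < \<infinity>"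
  shows "(g has_sum enn2real (\<Sum>\<^sub>\<infinity>i\<in>I. ennreal (g i))) I"
proof -
  let ?f = "\<Sum>\<^sub>\<infinity>i\<in>I. ennreal (g i)"
  have sup: "?f = (SUP F\<in>{F. finite F \<and> F \<subseteq> I}. ennreal (sum g F))"
    by (subst nonneg_infsum_complete) (auto intro!: SUP_cong simp: sum_ennreal nonneg subset_iff)
  have "sum g F \<le> enn2real ?f" if "F \<subseteq> I" "finite F" for F
  proof -
    have "ennreal (sum g F) \<le> ?f" unfolding sup by (rule SUP_upper) (use that in auto)
    then show ?thesis
      using fin that nonneg by (metis enn2real_ennreal enn2real_mono infinity_ennreal_def subsetD sum_nonneg)
  qed
  then have summable: "g summable_on I"
    by (intro nonneg_bdd_above_summable_on nonneg bdd_aboveI2) auto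
  have "ennreal (infsum g I) = ?f"
    unfolding sup using summable nonneg by (rule infsum_nonneg_is_SUPREMUM_ennreal)
  then have "enn2real ?f = infsum g I"
    using nonneg by (metis enn2real_ennreal infsum_nonneg)
  with summable show ?thesis by simp
qed

lemma integral_abs_le_integral:
  fixes f g :: "'a \<Rightarrow> real"
  assumes "integrable M f" "integrable M g" "\<And>x. \<bar>f x\<bar> \<le> g x"
  shows "\<bar>\<integral>x. f x \<partial>M\<bar> \<le> (\<integral>x. g x \<partial>M)"
  using assms by (intro order_trans[OF integral_abs_bound integral_mono]) auto

lemma sum_le_infsum_ennreal:
  fixes f :: "'i \<Rightarrow> ennreal"
  assumes "finite F" "F \<subseteq> I"
  shows "sum f F \<le> infsum f I"
  by (subst nonneg_infsum_complete) (use assms in \<open>auto intro!: SUP_upper\<close>)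

section \<open>Averages over shrinking balls\<close>

lemma tendsto_ball_average:
  fixes M :: "'a::metric_space measure" and g :: "'a \<Rightarrow> real"
  assumes "finite_measure M" and sets: "sets M = sets borel" and cont: "isCont g y" and g: "integrable M g"
    and pos: "\<And>r. 0 < r \<Longrightarrow> 0 < measure M (ball y r)"
  shows "((\<lambda>r. (\<integral>z. indicator (ball y r) z * g z \<partial>M) / measure M (ball y r)) \<longlongrightarrow> g y) (at_right 0)"
proof (rule tendstoI)
  interpret finite_measure M by fact
  fix e :: real assume e: "e > 0"
  have [measurable]: "ball y r \<in> sets M" for r using sets by simp
  obtain d where d: "d > 0" "\<And>z. dist z y < d \<Longrightarrow> dist (g z) (g y) < e / 2"
    using cont e unfolding continuous_at_eps_delta by (metis half_gt_zero)
  have "dist ((\<integral>z. indicator (ball y r) z * g z \<partial>M) / measure M (ball y r)) (g y) < e"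
    if r: "0 < r" "r < d" for r
  proof -
    let ?B = "ball y r"
    have i: "integrable M (\<lambda>z. indicator ?B z * g z)"
      using integrable_mult_indicator[OF _ g, of ?B] by simp
    have ind: "integrable M (\<lambda>z. indicator ?B z * c)" for c :: real
      using integrable_mult_indicator[of ?B M "\<lambda>_. c"] by simp
    have "\<bar>\<integral>z. indicator ?B z * (g z - g y) \<partial>M\<bar> \<le> (\<integral>z. indicator ?B z * (e / 2) \<partial>M)"
    proof (rule integral_abs_le_integral)
      show "integrable M (\<lambda>z. indicator ?B z * (g z - g y))"
        using integrable_mult_indicator[of ?B M "\<lambda>z. g z - g y"] g by simp
      show "\<bar>indicator ?B z * (g z - g y)\<bar> \<le> indicator ?B z * (e / 2)" for z
        using d(2)[of z] r by (auto simp: indicator_def dist_real_def dist_commute)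
    qed (rule ind)
    also have "\<dots> = measure M ?B * (e / 2)" by simp
    also have "(\<integral>z. indicator ?B z * (g z - g y) \<partial>M)
        = (\<integral>z. indicator ?B z * g z \<partial>M) - measure M ?B * g y"
      using i ind by (simp add: right_diff_distrib)
    finally have "\<bar>(\<integral>z. indicator ?B z * g z \<partial>M) / measure M ?B - g y\<bar> \<le> e / 2"
      using pos[OF r(1)] by (simp add: abs_le_iff field_simps)
    then show ?thesis using e by (simp add: dist_real_def)
  qed
  then show "\<forall>\<^sub>F r in at_right 0.
      dist ((\<integral>z. indicator (ball y r) z * g z \<partial>M) / measure M (ball y r)) (g y) < e"
    unfolding eventually_at_right_field using d(1) by auto
qed

text \<open>Take for \<open>\<delta> r\<close> the average of the absolute deviation of
  \<open>f\<close> from \<open>f y\<close>. If \<open>h\<close> lies below \<open>f\<close>, then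
  \<open>h z - f y\<close> is at most this deviation at \<open>z\<close>, so the same
  \<open>\<delta>\<close> works for every \<open>h\<close>. This uniformity lets one bound serve all
  finite partial sums of the series for \<open>f\<close>.\<close>

lemma Lebesgue_point_average_bound:
  fixes M :: "'a::metric_space measure" and f :: "'a \<Rightarrow> ennreal"
  assumes "finite_measure M" and sets: "sets M = sets borel" and y: "Lebesgue_point M f y"
  obtains \<delta> where "(\<delta> \<longlongrightarrow> 0) (at_right 0)"
    "\<forall>\<^sub>F r in at_right 0. \<forall>h. integrable M h \<longrightarrow> (\<forall>z. ennreal (h z) \<le> f z) \<longrightarrow>
       (\<integral>z. indicator (ball y r) z * h z \<partial>M) / measure M (ball y r) \<le> enn2real (f y) + \<delta> r"
proof -
  interpret finite_measure M by fact
  define D where "D z = e2ennreal \<bar>enn2ereal (f z) - enn2ereal (f y)\<bar>" for z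
  define q where "q r = (\<integral>\<^sup>+z\<in>ball y r. D z \<partial>M) / emeasure M (ball y r)" for r
  define fy where "fy = enn2real (f y)"
  have [measurable]: "ball y r \<in> sets M" for r using sets by simp
  have fy: "f y = ennreal fy" "0 \<le> fy"
    using y by (auto simp: Lebesgue_point_def fy_def)
  have q: "(q \<longlongrightarrow> 0) (at_right 0)" and pos: "\<And>r. r > 0 \<Longrightarrow> emeasure M (ball y r) > 0"
    using y by (auto simp: Lebesgue_point_def q_def[abs_def] D_def)
  have D: "ennreal (t - fy) \<le> D z" if "ennreal t \<le> f z" for t z
  proof (cases "f z")
    case (real s)
    then have "t \<le> s" using that by (simp add: ennreal_le_iff)
    then show ?thesis using real fy
      by (auto simp: D_def enn2ereal_ennreal intro: ennreal_leI)
  next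
    case top
    then show ?thesis using fy by (simp add: D_def enn2ereal_ennreal)
  qed
  \<comment> \<open>Finiteness is secured first because \<open>enn2real\<close> sends infinity to
    \<open>0\<close>, which would make the error term meaningless.\<close>
  have ev: "\<forall>\<^sub>F r in at_right 0. q r < \<infinity>"
    using order_tendstoD(2)[OF q, of \<infinity>] by simp
  show ?thesis
  proof (rule that[of "\<lambda>r. enn2real (q r)"])
    show "((\<lambda>r. enn2real (q r)) \<longlongrightarrow> 0) (at_right 0)"
      by (rule tendsto_enn2real) (use q in simp_all)
    show "\<forall>\<^sub>F r in at_right 0. \<forall>h. integrable M h \<longrightarrow> (\<forall>z. ennreal (h z) \<le> f z) \<longrightarrow>
       (\<integral>z. indicator (ball y r) z * h z \<partial>M) / measure M (ball y r) \<le> enn2real (f y) + enn2real (q r)"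
      using ev eventually_at_right_less[of "0::real"]
    proof eventually_elim
      case (elim r)
      let ?B = "ball y r"
      have m: "0 < measure M ?B"
        using pos[OF elim(2)] by (simp add: emeasure_eq_measure)
      have "(\<integral>\<^sup>+z\<in>?B. D z \<partial>M) \<noteq> \<infinity>"
        using elim(1) m unfolding q_def by (auto simp: emeasure_eq_measure ennreal_top_divide)
      then obtain n where n: "(\<integral>\<^sup>+z\<in>?B. D z \<partial>M) = ennreal n" "0 \<le> n"
        by (cases "\<integral>\<^sup>+z\<in>?B. D z \<partial>M") auto
      have q_eq: "enn2real (q r) = n / measure M ?B"
        using m n by (simp add: q_def emeasure_eq_measure divide_ennreal)
      show ?case
      proof (intro allI impI)
        fix h :: "'a \<Rightarrow> real" assume h: "integrable M h" "\<forall>z. ennreal (h z) \<le> f z"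
        have i: "integrable M (\<lambda>z. indicator ?B z * h z)"
          using integrable_mult_indicator[OF _ h(1), of ?B] by simp
        have ind: "integrable M (\<lambda>z. indicator ?B z * c)" for c :: real
          using integrable_mult_indicator[of ?B M "\<lambda>_. c"] by simp
        have i': "integrable M (\<lambda>z. indicator ?B z * (h z - fy))"
          using integrable_mult_indicator[of ?B M "\<lambda>z. h z - fy"] h(1) by simp
        have "(\<integral>z. indicator ?B z * h z \<partial>M) - measure M ?B * fy
            = (\<integral>z. indicator ?B z * (h z - fy) \<partial>M)"
          using i ind by (simp add: right_diff_distrib)
        \<comment> \<open>The real integral is at most the integral of the positive part;
          \<open>ennreal\<close> truncates negative values to \<open>0\<close>.\<close>
        also have "\<dots> \<le> enn2real (\<integral>\<^sup>+z. ennreal (indicator ?B z * (h z - fy)) \<partial>M)"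
          using i' by (simp add: real_lebesgue_integral_def)
        also have "\<dots> \<le> enn2real (\<integral>\<^sup>+z\<in>?B. D z \<partial>M)"
        proof (rule enn2real_mono)
          show "(\<integral>\<^sup>+z. ennreal (indicator ?B z * (h z - fy)) \<partial>M) \<le> (\<integral>\<^sup>+z\<in>?B. D z \<partial>M)"
            by (rule nn_integral_mono) (use h(2) D in \<open>auto simp: indicator_def\<close>)
        qed (use n in simp)
        finally show "(\<integral>z. indicator ?B z * h z \<partial>M) / measure M ?B
            \<le> enn2real (f y) + enn2real (q r)"
          using m n q_eq by (simp add: fy_def[symmetric] field_simps)
      qed
    qed
  qed
qed

section \<open>The operator \<open>K_op\<close> under the fourth moment condition\<close>

lemma dist_square_le: "(dist x y)\<^sup>2 \<le> 2 * (dist z x)\<^sup>2 + 2 * (dist z y)\<^sup>2"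
  for x y z :: "'a::metric_space"
proof -
  have "(dist x y)\<^sup>2 \<le> (dist z x + dist z y)\<^sup>2"
    by (intro power_mono) (auto simp: dist_triangle3 dist_triangle2 dist_commute)
  also have "\<dots> \<le> 2 * (dist z x)\<^sup>2 + 2 * (dist z y)\<^sup>2"
    using sum_squares_bound[of "dist z x" "dist z y"] by (simp add: power2_sum)
  finally show ?thesis .
qed

locale fourth_moment_space = prob_space M for M :: "'a::polish_space measure" +
  assumes sets_borel [measurable_cong]: "sets M = sets borel"
    and fourth_moment: "\<exists>x0. integrable M (\<lambda>y. (dist x0 y) ^ 4)"
begin

sublocale pair: pair_sigma_finite M M ..

text \<open>The fourth moment condition is this statement at one base point;
  \<open>dist_square_le\<close> moves it to every \<open>x\<close>.\<close>

lemma L2_dist_square: "(\<lambda>y. (dist x y)\<^sup>2) \<in> L2_functions M"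
proof -
  obtain x0 where "integrable M (\<lambda>y. (dist x0 y) ^ 4)" using fourth_moment by blast
  then have "(\<lambda>y. (dist x0 y)\<^sup>2) \<in> L2_functions M"
    by (simp add: L2_functions_def power_mult[symmetric])
  then have "(\<lambda>y. 2 * (dist x0 x)\<^sup>2 + 2 * (dist x0 y)\<^sup>2) \<in> L2_functions M"
    by (intro L2_add L2_const L2_cmult)
  then show ?thesis
    by (rule L2_bound) (use dist_square_le[of x _ x0] in auto)
qed

lemma L2_sqdist_kernel: "sqdist_kernel x \<in> L2_functions M"
  using L2_cmult[OF L2_dist_square, of "-(1/2)" x] by (simp add: sqdist_kernel_def[abs_def])

text \<open>Dominated convergence along a sequence tending to \<open>a\<close>. The sequence stays
  within a distance \<open>C\<close> of \<open>a\<close>, so \<open>dist_square_le\<close> through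
  \<open>a\<close> bounds all the kernels by one square-integrable function.\<close>

lemma continuous_K_op:
  assumes g: "g \<in> L2_functions M"
  shows "continuous_on UNIV (K_op M g)"
  unfolding continuous_on_sequentially
proof (intro allI ballI impI, elim conjE)
  fix X :: "nat \<Rightarrow> 'a" and a :: 'a assume X: "X \<longlonglongrightarrow> a"
  have L2_abs: "(\<lambda>y. \<bar>g y\<bar>) \<in> L2_functions M"
    using g by (auto simp: L2_functions_def)
  have "Bseq (\<lambda>n. dist a (X n))"
    by (rule convergent_imp_Bseq[OF convergentI[OF tendsto_dist[OF tendsto_const X]]])
  then obtain C where "\<forall>n. norm (dist a (X n)) \<le> C"
    by (rule BseqE)
  then have C: "dist a (X n) \<le> C" for n by simp
  show "(K_op M g \<circ> X) \<longlonglongrightarrow> K_op M g a"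
    unfolding o_def K_op_def
  proof (rule integral_dominated_convergence[where w = "\<lambda>y. (C\<^sup>2 + (dist a y)\<^sup>2) * \<bar>g y\<bar>"])
    show "integrable M (\<lambda>y. (C\<^sup>2 + (dist a y)\<^sup>2) * \<bar>g y\<bar>)"
      by (intro L2_integrable_mult L2_add L2_const L2_dist_square L2_abs)
    show "AE y in M. (\<lambda>n. sqdist_kernel (X n) y * g y) \<longlonglongrightarrow> sqdist_kernel a y * g y"
      unfolding sqdist_kernel_def
      by (intro AE_I2 tendsto_mult tendsto_const tendsto_power tendsto_dist X)
    show "AE y in M. norm (sqdist_kernel (X n) y * g y) \<le> (C\<^sup>2 + (dist a y)\<^sup>2) * \<bar>g y\<bar>" for n
    proof (rule AE_I2)
      fix y
      have "(dist a (X n))\<^sup>2 \<le> C\<^sup>2" using C by (intro power_mono) auto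
      then have "\<bar>sqdist_kernel (X n) y\<bar> \<le> C\<^sup>2 + (dist a y)\<^sup>2"
        using dist_square_le[of "X n" y a] by (simp add: sqdist_kernel_def)
      then show "norm (sqdist_kernel (X n) y * g y) \<le> (C\<^sup>2 + (dist a y)\<^sup>2) * \<bar>g y\<bar>"
        by (simp add: abs_mult mult_right_mono)
    qed
  qed (intro borel_measurable_integrable L2_integrable_mult L2_sqdist_kernel g)+
qed

text \<open>Splitting the kernel at a base point \<open>x0\<close> bounds \<open>K_op M g\<close> by
  an affine function of the squared distance to \<open>x0\<close>, which is
  square-integrable.\<close>

lemma L2_K_op:
  assumes g: "g \<in> L2_functions M"
  shows "K_op M g \<in> L2_functions M"
proof -
  fix x0 :: 'a
  have L2_abs: "(\<lambda>y. \<bar>g y\<bar>) \<in> L2_functions M"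
    using g by (auto simp: L2_functions_def)
  define A C where "A = (\<integral>y. \<bar>g y\<bar> \<partial>M)" and "C = (\<integral>y. (dist x0 y)\<^sup>2 * \<bar>g y\<bar> \<partial>M)"
  have i: "integrable M (\<lambda>y. \<bar>g y\<bar>)" "integrable M (\<lambda>y. (dist x0 y)\<^sup>2 * \<bar>g y\<bar>)"
    using L2_integrable[OF L2_abs] L2_integrable_mult[OF L2_dist_square L2_abs] by auto
  have AC: "0 \<le> A" "0 \<le> C" by (auto simp: A_def C_def)
  show ?thesis
  proof (rule L2_bound)
    show "(\<lambda>x. A * (dist x0 x)\<^sup>2 + C) \<in> L2_functions M"
      by (intro L2_add L2_const L2_cmult L2_dist_square)
    show "K_op M g \<in> borel_measurable M"
      using borel_measurable_continuous_onI[OF continuous_K_op[OF g]] by simp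
    fix x
    have "\<bar>K_op M g x\<bar> \<le> (\<integral>y. (dist x0 x)\<^sup>2 * \<bar>g y\<bar> + (dist x0 y)\<^sup>2 * \<bar>g y\<bar> \<partial>M)"
      unfolding K_op_def
    proof (rule integral_abs_le_integral)
      show "integrable M (\<lambda>y. sqdist_kernel x y * g y)"
        by (rule L2_integrable_mult[OF L2_sqdist_kernel g])
      fix y
      have "\<bar>sqdist_kernel x y\<bar> \<le> (dist x0 x)\<^sup>2 + (dist x0 y)\<^sup>2"
        using dist_square_le[of x y x0] by (simp add: sqdist_kernel_def)
      then show "\<bar>sqdist_kernel x y * g y\<bar> \<le> (dist x0 x)\<^sup>2 * \<bar>g y\<bar> + (dist x0 y)\<^sup>2 * \<bar>g y\<bar>"
        by (simp add: abs_mult mult_right_mono flip: distrib_right)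
    qed (use i in simp)
    also have "\<dots> = A * (dist x0 x)\<^sup>2 + C" using i by (simp add: A_def C_def)
    finally show "\<bar>K_op M g x\<bar> \<le> \<bar>A * (dist x0 x)\<^sup>2 + C\<bar>" using AC by simp
  qed
qed

text \<open>Fubini's theorem and the symmetry of the kernel.\<close>

lemma integral_K_op:
  assumes g: "g \<in> L2_functions M"
  shows "(\<integral>x. K_op M g x \<partial>M) = (\<integral>y. K_op M (\<lambda>_. 1) y * g y \<partial>M)"
proof -
  have g' [measurable]: "g \<in> borel_measurable M" using g by (simp add: L2_functions_def)
  have L2_abs: "(\<lambda>y. \<bar>g y\<bar>) \<in> L2_functions M"
    using g by (auto simp: L2_functions_def)
  have [measurable]: "(\<lambda>(x, y). dist x y) \<in> borel_measurable (M \<Otimes>\<^sub>M M)"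
    by measurable
  have "integrable (M \<Otimes>\<^sub>M M) (\<lambda>(x, y). sqdist_kernel x y * g y)"
  proof (rule pair.Fubini_integrable)
    show "(\<lambda>(x, y). sqdist_kernel x y * g y) \<in> borel_measurable (M \<Otimes>\<^sub>M M)"
      unfolding sqdist_kernel_def by measurable
    \<comment> \<open>The kernel is nonpositive, so the absolute inner integral is minus
      \<open>K_op\<close> of the absolute value of \<open>g\<close>, whose integrability is already
      known.\<close>
    have "norm (sqdist_kernel x y * g y) = (-1) * (sqdist_kernel x y * \<bar>g y\<bar>)" for x y
      by (simp add: sqdist_kernel_def abs_mult)
    then have "(\<lambda>x. \<integral>y. norm (sqdist_kernel x y * g y) \<partial>M) = (\<lambda>x. (-1) * K_op M (\<lambda>y. \<bar>g y\<bar>) x)"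
      by (simp only: integral_mult_right_zero K_op_def)
    then show "integrable M (\<lambda>x. \<integral>y. norm (case (x, y) of (x, y) \<Rightarrow> sqdist_kernel x y * g y) \<partial>M)"
      using L2_integrable[OF L2_K_op[OF L2_abs]] by simp
    show "AE x in M. integrable M (\<lambda>y. case (x, y) of (x, y) \<Rightarrow> sqdist_kernel x y * g y)"
      using L2_integrable_mult[OF L2_sqdist_kernel g] by simp
  qed
  from pair.Fubini_integral[OF this]
  have "(\<integral>x. K_op M g x \<partial>M) = (\<integral>y. (\<integral>x. sqdist_kernel x y * g y \<partial>M) \<partial>M)"
    by (simp add: K_op_def)
  then show ?thesis
    by (simp add: K_op_def sqdist_kernel_def dist_commute)
qed

section \<open>The centered kernel and the continuous representatives\<close>

text \<open>By symmetry both marginals of the kernel are \<open>K_op\<close> of the constant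
  \<open>1\<close>, so integrability and continuity are inherited from \<open>K_op\<close>.\<close>

lemma T_kernel_eq:
  "T_kernel M x y = sqdist_kernel x y - K_op M (\<lambda>_. 1) x - K_op M (\<lambda>_. 1) y
     + (\<integral>z. K_op M (\<lambda>_. 1) z \<partial>M)"
  by (simp add: T_kernel_def K_op_def sqdist_kernel_def dist_commute)

lemma L2_T_kernel: "T_kernel M x \<in> L2_functions M"
  unfolding T_kernel_eq[abs_def]
  by (intro L2_add L2_diff L2_const L2_K_op L2_sqdist_kernel)

lemma continuous_T_kernel: "continuous_on UNIV (T_kernel M x)"
  unfolding T_kernel_eq[abs_def] sqdist_kernel_def
  by (intro continuous_intros continuous_K_op L2_const)

text \<open>The dependence on \<open>x\<close> enters only through \<open>K_op M g\<close> and
  \<open>K_op\<close> of \<open>1\<close>. This gives both the integral form of \<open>T_op\<close>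
  and the continuity of the representatives.\<close>

lemma integral_T_kernel_mult:
  assumes g: "g \<in> L2_functions M"
  shows "(\<integral>y. T_kernel M x y * g y \<partial>M) = K_op M g x - K_op M (\<lambda>_. 1) x * (\<integral>y. g y \<partial>M)
    - (\<integral>y. K_op M (\<lambda>_. 1) y * g y \<partial>M) + (\<integral>z. K_op M (\<lambda>_. 1) z \<partial>M) * (\<integral>y. g y \<partial>M)"
proof -
  let ?\<phi> = "K_op M (\<lambda>_. 1)"
  have i: "integrable M (\<lambda>y. sqdist_kernel x y * g y)" "integrable M (\<lambda>y. ?\<phi> y * g y)" "integrable M g"
    using L2_integrable_mult[OF L2_sqdist_kernel g] L2_integrable_mult[OF L2_K_op[OF L2_const] g]
      L2_integrable[OF g] by auto
  have "(\<integral>y. T_kernel M x y * g y \<partial>M) = (\<integral>y. sqdist_kernel x y * g y - ?\<phi> x * g y - ?\<phi> y * g y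
      + (\<integral>z. ?\<phi> z \<partial>M) * g y \<partial>M)"
    unfolding T_kernel_eq by (simp add: algebra_simps)
  also have "\<dots> = (\<integral>y. sqdist_kernel x y * g y \<partial>M) - ?\<phi> x * (\<integral>y. g y \<partial>M)
      - (\<integral>y. ?\<phi> y * g y \<partial>M) + (\<integral>z. ?\<phi> z \<partial>M) * (\<integral>y. g y \<partial>M)"
    using i by simp
  finally show ?thesis by (simp add: K_op_def)
qed

text \<open>The inner projection contributes the marginal in \<open>x\<close>, the outer one
  subtracts the mean of the result; \<open>integral_K_op\<close> identifies that mean with the
  remaining two terms.\<close>

lemma T_op_eq_integral:
  assumes g: "g \<in> L2_functions M"
  shows "T_op M g x = (\<integral>y. T_kernel M x y * g y \<partial>M)"
proof -
  let ?\<phi> = "K_op M (\<lambda>_. 1)"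
  define m where "m = (\<integral>y. g y \<partial>M)"
  have K: "K_op M (P_op M g) = (\<lambda>x. K_op M g x - m * ?\<phi> x)"
  proof
    fix x
    have "K_op M (P_op M g) x = (\<integral>y. sqdist_kernel x y * g y - m * sqdist_kernel x y \<partial>M)"
      unfolding K_op_def P_op_def m_def by (simp add: algebra_simps)
    also have "\<dots> = K_op M g x - m * ?\<phi> x"
      using L2_integrable_mult[OF L2_sqdist_kernel g] L2_integrable[OF L2_sqdist_kernel]
      by (simp add: K_op_def)
    finally show "K_op M (P_op M g) x = K_op M g x - m * ?\<phi> x" .
  qed
  have "(\<integral>x. K_op M (P_op M g) x \<partial>M) = (\<integral>x. K_op M g x \<partial>M) - m * (\<integral>x. ?\<phi> x \<partial>M)"
    unfolding K using L2_integrable[OF L2_K_op[OF g]] L2_integrable[OF L2_K_op[OF L2_const]] by simp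
  then show ?thesis
    unfolding T_op_def P_op_def[of M "K_op M (P_op M g)"]
    unfolding K integral_K_op[OF g] integral_T_kernel_mult[OF g] m_def by simp
qed

lemma continuous_continuous_rep:
  assumes "g \<in> L2_functions M"
  shows "continuous_on UNIV (continuous_rep M l g)"
  unfolding continuous_rep_def[abs_def] integral_T_kernel_mult[OF assms]
  by (intro continuous_intros continuous_K_op L2_const assms)

lemma continuous_rep_AE_eq:
  assumes "T_eigenfunction M l g" "l \<noteq> 0"
  shows "AE x in M. continuous_rep M l g x = g x"
  using assms by (auto simp: T_eigenfunction_def continuous_rep_def T_op_eq_integral[symmetric])

lemma L2_continuous_rep:
  assumes g: "T_eigenfunction M l g"
  shows "continuous_rep M l g \<in> L2_functions M"
proof (cases "l = 0")
  case True
  \<comment> \<open>With \<open>inverse 0 = 0\<close> the dummy representative is the zero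
    function.\<close>
  then show ?thesis using L2_const[of 0] by (simp add: continuous_rep_def[abs_def])
next
  case False
  have g': "g \<in> L2_functions M" using g by (simp add: T_eigenfunction_def)
  have [measurable]: "continuous_rep M l g \<in> borel_measurable M"
    using borel_measurable_continuous_onI[OF continuous_continuous_rep[OF g', of l]] by simp
  have "AE x in M. (g x)\<^sup>2 = (continuous_rep M l g x)\<^sup>2"
    using continuous_rep_AE_eq[OF g False] by eventually_elim simp
  then have "integrable M (\<lambda>x. (continuous_rep M l g x)\<^sup>2)"
    using g' by (subst integrable_cong_AE[symmetric, of "\<lambda>x. (g x)\<^sup>2"]) (auto simp: L2_functions_def)
  then show ?thesis by (simp add: L2_functions_def)
qed

text \<open>For a nonzero eigenvalue this is the definition of the representative and holds at every
  \<open>x\<close>. For eigenvalue \<open>0\<close> it is the eigenvalue equation, valid off a null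
  set; the union over the countable \<open>I\<close> is again null.\<close>

lemma AE_integral_T_kernel_eq:
  fixes I :: "nat set"
  assumes eig: "\<And>i. i \<in> I \<Longrightarrow> T_eigenfunction M (lam i) (u i)"
  shows "AE x in M. \<forall>i\<in>I. (\<integral>t. T_kernel M x t * u i t \<partial>M) = lam i * continuous_rep M (lam i) (u i) x"
proof -
  have "AE x in M. (\<integral>t. T_kernel M x t * u i t \<partial>M) = lam i * continuous_rep M (lam i) (u i) x"
    if "i \<in> I" for i
  proof (cases "lam i = 0")
    case True
    then show ?thesis
      using eig[OF that] by (auto simp: T_eigenfunction_def T_op_eq_integral[symmetric])
  next
    case False
    then show ?thesis by (simp add: continuous_rep_def)
  qed
  then show ?thesis by (intro AE_ball_countable'[of I]) auto
qed

section \<open>Pointwise expansion of the centered kernel\<close>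

text \<open>Only the second variable is averaged, hence the Lebesgue point condition at
  \<open>y\<close>, while at \<open>x\<close> finiteness of \<open>f\<close> makes the fixed half of
  the majorant summable. The statement concerns individual points so that it can be used on the
  diagonal.\<close>

lemma T_kernel_expansion:
  fixes I :: "nat set" and u lam
  defines "w \<equiv> \<lambda>i. continuous_rep M (lam i) (u i)"
  defines "f \<equiv> \<lambda>z. \<Sum>\<^sub>\<infinity>i\<in>I. ennreal (\<bar>lam i\<bar> * (w i z)\<^sup>2)"
  assumes onb: "L2_orthonormal_basis M I u"
    and eig: "\<And>i. i \<in> I \<Longrightarrow> T_eigenfunction M (lam i) (u i)"
    and x: "\<And>i. i \<in> I \<Longrightarrow> (\<integral>t. T_kernel M x t * u i t \<partial>M) = lam i * w i x"
    and fx: "f x < \<infinity>" and y: "Lebesgue_point M f y"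
  shows "((\<lambda>i. lam i * (w i x * w i y)) has_sum T_kernel M x y) I"
proof -
  define m where "m r = measure M (ball y r)" for r
  define av where "av g r = (\<integral>z. indicator (ball y r) z * g z \<partial>M) / m r" for g :: "'a \<Rightarrow> real" and r
  have [measurable]: "ball y r \<in> sets M" for r by simp
  have m: "0 < m r" if "0 < r" for r
    using y that by (auto simp: Lebesgue_point_def m_def emeasure_eq_measure)
  have fy: "f y < \<infinity>" using y by (simp add: Lebesgue_point_def)
  have u: "u i \<in> L2_functions M" if "i \<in> I" for i
    using eig[OF that] by (simp add: T_eigenfunction_def)
  have w: "w i \<in> L2_functions M" if "i \<in> I" for i
    unfolding w_def by (rule L2_continuous_rep[OF eig[OF that]])
  have w_int: "integrable M (w i)" "integrable M (\<lambda>z. (w i z)\<^sup>2)" if "i \<in> I" for i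
    using L2_integrable[OF w[OF that]] w[OF that] by (auto simp: L2_functions_def)
  have w_cont: "isCont (w i) z" if "i \<in> I" for i z
    using continuous_continuous_rep[OF u[OF that]] by (simp add: w_def continuous_on_eq_continuous_at)
  have ind_int: "integrable M (\<lambda>z. indicator (ball y r) z * g z)" if "integrable M g"
    for r and g :: "'a \<Rightarrow> real"
    using integrable_mult_indicator[OF _ that, of "ball y r"] by simp
  have av_lim: "(av g \<longlongrightarrow> g y) (at_right 0)" if "integrable M g" "isCont g y" for g
    unfolding av_def m_def using sets_borel that m finite_measure_axioms by (intro tendsto_ball_average) (auto simp: m_def)
  obtain \<delta> where \<delta>: "(\<delta> \<longlongrightarrow> 0) (at_right 0)" and
    bound: "\<forall>\<^sub>F r in at_right 0. \<forall>h. integrable M h \<longrightarrow> (\<forall>z. ennreal (h z) \<le> f z) \<longrightarrow>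
       av h r \<le> enn2real (f y) + \<delta> r"
    using Lebesgue_point_average_bound[OF finite_measure_axioms sets_borel y] unfolding av_def m_def by blast
  have f_has_sum: "((\<lambda>i. \<bar>lam i\<bar> * (w i z)\<^sup>2) has_sum enn2real (f z)) I" if "f z < \<infinity>" for z
    using that unfolding f_def by (intro has_sum_enn2real_infsum) auto
  \<comment> \<open>The majorant comes from \<open>2ab \<le> a^2 + b^2\<close> applied to
    \<open>w i x\<close> and \<open>w i z\<close> under the average.\<close>
  define b where "b r i = 1/2 * (\<bar>lam i\<bar> * (w i x)\<^sup>2 + \<bar>lam i\<bar> * av (\<lambda>z. (w i z)\<^sup>2) r)" for r i
  define b' where "b' i = 1/2 * (\<bar>lam i\<bar> * (w i x)\<^sup>2 + \<bar>lam i\<bar> * (w i y)\<^sup>2)" for i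
  show ?thesis
  proof (rule has_sum_dominated_tendsto[where H = "at_right (0::real)"
        and a = "\<lambda>r i. lam i * (w i x * av (w i) r)" and S = "av (T_kernel M x)"
        and b = b and b' = b' and B = "\<lambda>r. 1/2 * (enn2real (f x) + (enn2real (f y) + \<delta> r))"
        and B' = "1/2 * (enn2real (f x) + enn2real (f y))"])
    show "\<forall>\<^sub>F r in at_right 0. ((\<lambda>i. lam i * (w i x * av (w i) r)) has_sum av (T_kernel M x) r) I"
      using eventually_at_right_less[of "0::real"]
    proof eventually_elim
      case (elim r)
      let ?B = "ball y r"
      have sum: "((\<lambda>i. 1 / m r * ((\<integral>z. T_kernel M x z * u i z \<partial>M) * (\<integral>z. indicator ?B z * u i z \<partial>M)))
          has_sum 1 / m r * (\<integral>z. T_kernel M x z * indicator ?B z \<partial>M)) I"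
        by (intro has_sum_cmult_right L2_Parseval_inner[OF onb] L2_T_kernel L2_indicator) simp
      have terms: "1 / m r * ((\<integral>z. T_kernel M x z * u i z \<partial>M) * (\<integral>z. indicator ?B z * u i z \<partial>M))
          = lam i * (w i x * av (w i) r)" if i: "i \<in> I" for i
      \<comment> \<open>Parseval's identity involves \<open>u i\<close>, the claim
        \<open>w i\<close>. For eigenvalue \<open>0\<close> the kernel coefficient vanishes by
        \<open>x\<close>, so both sides are zero; otherwise the two functions agree almost
        everywhere and have equal integrals over the ball.\<close>
      proof (cases "lam i = 0")
        case True
        then show ?thesis using x[OF i] by simp
      next
        case False
        have "(\<integral>z. indicator ?B z * u i z \<partial>M) = (\<integral>z. indicator ?B z * w i z \<partial>M)"
        proof (rule integral_cong_AE)
          show "AE z in M. indicator ?B z * u i z = indicator ?B z * w i z"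
            using continuous_rep_AE_eq[OF eig[OF i] False] by eventually_elim (simp add: w_def)
        qed (use u[OF i] w[OF i] in \<open>auto simp: L2_functions_def\<close>)
        then show ?thesis using x[OF i] by (simp add: av_def)
      qed
      have "((\<lambda>i. lam i * (w i x * av (w i) r))
          has_sum 1 / m r * (\<integral>z. T_kernel M x z * indicator ?B z \<partial>M)) I"
        by (rule iffD1[OF has_sum_cong sum]) (rule terms)
      then show ?case by (simp add: av_def mult.commute)
    qed
    show "\<forall>\<^sub>F r in at_right 0. \<forall>i\<in>I. \<bar>lam i * (w i x * av (w i) r)\<bar> \<le> b r i"
      using eventually_at_right_less[of "0::real"]
    proof eventually_elim
      case (elim r)
      let ?B = "ball y r"
      show ?case
      proof
        fix i assume i: "i \<in> I"
        \<comment> \<open>The constant \<open>w i x\<close> is kept under the integral so that the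
          quadratic inequality applies pointwise in \<open>z\<close>.\<close>
        have "\<bar>\<integral>z. w i x * (indicator ?B z * w i z) \<partial>M\<bar>
            \<le> (\<integral>z. 1/2 * (indicator ?B z * (w i x)\<^sup>2 + indicator ?B z * (w i z)\<^sup>2) \<partial>M)"
        proof (rule integral_abs_le_integral)
          show "\<bar>w i x * (indicator ?B z * w i z)\<bar>
              \<le> 1/2 * (indicator ?B z * (w i x)\<^sup>2 + indicator ?B z * (w i z)\<^sup>2)" for z
            using sum_squares_bound[of "\<bar>w i x\<bar>" "\<bar>w i z\<bar>"] by (simp add: indicator_def abs_mult)
        qed (use ind_int[OF w_int(1)[OF i]] ind_int[OF w_int(2)[OF i]]
            ind_int[of "\<lambda>_. (w i x)\<^sup>2"] in auto)
        also have "\<dots> = 1/2 * ((w i x)\<^sup>2 * m r + (\<integral>z. indicator ?B z * (w i z)\<^sup>2 \<partial>M))"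
          using ind_int[OF w_int(2)[OF i]] ind_int[of "\<lambda>_. (w i x)\<^sup>2"] by (simp add: m_def)
        finally have "\<bar>w i x * (\<integral>z. indicator ?B z * w i z \<partial>M)\<bar>
            \<le> 1/2 * ((w i x)\<^sup>2 * m r + (\<integral>z. indicator ?B z * (w i z)\<^sup>2 \<partial>M))"
          by (simp only: integral_mult_right_zero)
        then have "\<bar>w i x * av (w i) r\<bar> \<le> 1/2 * ((w i x)\<^sup>2 + av (\<lambda>z. (w i z)\<^sup>2) r)"
          using m[OF elim] by (simp add: av_def abs_mult field_simps)
        then have "\<bar>lam i\<bar> * \<bar>w i x * av (w i) r\<bar>
            \<le> \<bar>lam i\<bar> * (1/2 * ((w i x)\<^sup>2 + av (\<lambda>z. (w i z)\<^sup>2) r))"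
          by (rule mult_left_mono) simp
        then show "\<bar>lam i * (w i x * av (w i) r)\<bar> \<le> b r i"
          unfolding b_def abs_mult[of "lam i"] by (simp add: algebra_simps)
      qed
    qed
    show "\<forall>\<^sub>F r in at_right 0. \<forall>F. finite F \<longrightarrow> F \<subseteq> I \<longrightarrow>
        sum (b r) F \<le> 1/2 * (enn2real (f x) + (enn2real (f y) + \<delta> r))"
      using bound
    proof eventually_elim
      case (elim r)
      show ?case
      proof (intro allI impI)
        fix F assume F: "finite F" "F \<subseteq> I"
        \<comment> \<open>A finite partial sum lies below \<open>f\<close> everywhere, so it may
          serve as \<open>h\<close> in \<open>bound\<close>.\<close>
        have "av (\<lambda>z. \<Sum>i\<in>F. \<bar>lam i\<bar> * (w i z)\<^sup>2) r \<le> enn2real (f y) + \<delta> r"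
        proof (rule elim[rule_format])
          show "integrable M (\<lambda>z. \<Sum>i\<in>F. \<bar>lam i\<bar> * (w i z)\<^sup>2)"
            using F w_int by (intro Bochner_Integration.integrable_sum integrable_mult_right) auto
          show "ennreal (\<Sum>i\<in>F. \<bar>lam i\<bar> * (w i z)\<^sup>2) \<le> f z" for z
            using sum_le_infsum_ennreal[OF F, of "\<lambda>i. ennreal (\<bar>lam i\<bar> * (w i z)\<^sup>2)"]
            by (simp add: f_def)
        qed
        also have "av (\<lambda>z. \<Sum>i\<in>F. \<bar>lam i\<bar> * (w i z)\<^sup>2) r = (\<Sum>i\<in>F. \<bar>lam i\<bar> * av (\<lambda>z. (w i z)\<^sup>2) r)"
        proof -
          have "(\<integral>z. indicator (ball y r) z * (\<Sum>i\<in>F. \<bar>lam i\<bar> * (w i z)\<^sup>2) \<partial>M)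
              = (\<integral>z. (\<Sum>i\<in>F. \<bar>lam i\<bar> * (indicator (ball y r) z * (w i z)\<^sup>2)) \<partial>M)"
            by (simp add: sum_distrib_left algebra_simps)
          also have "\<dots> = (\<Sum>i\<in>F. \<bar>lam i\<bar> * (\<integral>z. indicator (ball y r) z * (w i z)\<^sup>2 \<partial>M))"
            using F ind_int[OF w_int(2)] by (subst Bochner_Integration.integral_sum) auto
          finally show ?thesis by (simp add: av_def sum_divide_distrib)
        qed
        finally have "(\<Sum>i\<in>F. \<bar>lam i\<bar> * av (\<lambda>z. (w i z)\<^sup>2) r) \<le> enn2real (f y) + \<delta> r" .
        moreover have "(\<Sum>i\<in>F. \<bar>lam i\<bar> * (w i x)\<^sup>2) \<le> enn2real (f x)"
          by (rule finite_sum_le_has_sum[OF f_has_sum[OF fx] F]) simp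
        ultimately show "sum (b r) F \<le> 1/2 * (enn2real (f x) + (enn2real (f y) + \<delta> r))"
          unfolding b_def by (simp add: sum.distrib flip: sum_distrib_left sum_divide_distrib)
      qed
    qed
    show "((\<lambda>r. lam i * (w i x * av (w i) r)) \<longlongrightarrow> lam i * (w i x * w i y)) (at_right 0)" if "i \<in> I" for i
      by (intro tendsto_intros av_lim w_int w_cont that)
    show "((\<lambda>r. b r i) \<longlongrightarrow> b' i) (at_right 0)" if "i \<in> I" for i
      unfolding b_def b'_def
      by (intro tendsto_intros av_lim[of "\<lambda>z. (w i z)\<^sup>2"] w_int continuous_intros w_cont that)
    \<comment> \<open>Continuity in the second variable makes the averages converge at the given
      \<open>y\<close> itself.\<close>
    show "(av (T_kernel M x) \<longlongrightarrow> T_kernel M x y) (at_right 0)"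
      using continuous_T_kernel[of x]
      by (intro av_lim L2_integrable L2_T_kernel) (simp add: continuous_on_eq_continuous_at)
    show "((\<lambda>r. 1/2 * (enn2real (f x) + (enn2real (f y) + \<delta> r))) \<longlongrightarrow>
        1/2 * (enn2real (f x) + enn2real (f y))) (at_right 0)"
      by (rule tendsto_eq_intros \<delta> refl)+ simp
    show "(b' has_sum 1/2 * (enn2real (f x) + enn2real (f y))) I"
      unfolding b'_def[abs_def] by (intro has_sum_cmult_right has_sum_add f_has_sum fx fy)
  qed simp
qed

section \<open>Recovering the squared distance almost everywhere\<close>

text \<open>The marginal terms and the constant cancel, and the uncentered kernel vanishes on the
  diagonal.\<close>

lemma dist_square_eq_T_kernel:
  "(dist x y)\<^sup>2 = T_kernel M x x + T_kernel M y y - 2 * T_kernel M x y"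
  by (simp add: T_kernel_eq sqdist_kernel_def)

end

text \<open>The set where \<open>P\<close> fails need not be measurable, so it is enclosed in a
  measurable null set \<open>N\<close> before passing to the product.\<close>

lemma (in sigma_finite_measure) AE_pair_conj:
  assumes "AE x in M. P x"
  shows "AE (x, y) in M \<Otimes>\<^sub>M M. P x \<and> P y"
proof -
  interpret pair_sigma_finite M M ..
  obtain N where N: "N \<in> null_sets M" "{x \<in> space M. \<not> P x} \<subseteq> N"
    using assms by (auto elim!: AE_E simp: null_sets_def)
  have [measurable]: "N \<in> sets M" using N by auto
  have "AE x in M. x \<notin> N" using N(1) by (rule AE_not_in)
  then have "AE z in M \<Otimes>\<^sub>M M. fst z \<notin> N \<and> snd z \<notin> N"
    by (intro AE_pair_measure) (auto elim!: eventually_mono)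
  then show ?thesis
    by (rule AE_mp) (use N(2) in \<open>auto simp: space_pair_measure intro!: AE_I2\<close>)
qed

theorem theorem4p2:
  fixes \<mu> :: "'a::polish_space measure"
    and I :: "nat set"
    and u :: "nat \<Rightarrow> 'a \<Rightarrow> real"
    and lam :: "nat \<Rightarrow> real"
  assumes "prob_space \<mu>"
    and "sets \<mu> = sets borel"
    and "\<exists>x0. integrable \<mu> (\<lambda>y. (dist x0 y) ^ 4)"
    and "L2_orthonormal_basis \<mu> I u"
    and "\<And>i. i \<in> I \<Longrightarrow> T_eigenfunction \<mu> (lam i) (u i)"
    and "(\<lambda>i. \<bar>lam i\<bar>) summable_on I"
    and "AE x in \<mu>. Lebesgue_point \<mu>
           (\<lambda>z. \<Sum>\<^sub>\<infinity>i\<in>I. ennreal (\<bar>lam i\<bar> * (continuous_rep \<mu> (lam i) (u i) z)\<^sup>2)) x"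
  shows "AE (x, y) in \<mu> \<Otimes>\<^sub>M \<mu>.
           ((\<lambda>i. lam i * (continuous_rep \<mu> (lam i) (u i) x - continuous_rep \<mu> (lam i) (u i) y)\<^sup>2)
              has_sum (dist x y)\<^sup>2) I"
proof -
  interpret fourth_moment_space \<mu>
    using assms(1-3) by (simp add: fourth_moment_space_def fourth_moment_space_axioms_def)
  let ?w = "\<lambda>i. continuous_rep \<mu> (lam i) (u i)"
  \<comment> \<open>Both requirements concern a single point, so the expansion holds for every pair
    of good points. This includes the diagonal, which an almost-everywhere statement on the product
    could miss.\<close>
  define good where "good x \<longleftrightarrow>
      Lebesgue_point \<mu> (\<lambda>z. \<Sum>\<^sub>\<infinity>i\<in>I. ennreal (\<bar>lam i\<bar> * (?w i z)\<^sup>2)) x \<and>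
      (\<forall>i\<in>I. (\<integral>t. T_kernel \<mu> x t * u i t \<partial>\<mu>) = lam i * ?w i x)" for x
  have "AE x in \<mu>. good x"
    using assms(7) AE_integral_T_kernel_eq[OF assms(5)] by (simp add: good_def)
  then have "AE (x, y) in \<mu> \<Otimes>\<^sub>M \<mu>. good x \<and> good y"
    by (rule AE_pair_conj)
  moreover have "((\<lambda>i. lam i * (?w i x - ?w i y)\<^sup>2) has_sum (dist x y)\<^sup>2) I"
    if "good x" "good y" for x y
  proof -
    have expansion: "((\<lambda>i. lam i * (?w i x' * ?w i y')) has_sum T_kernel \<mu> x' y') I"
      if "good x'" "good y'" for x' y'
      using that by (intro T_kernel_expansion assms(4,5)) (auto simp: good_def Lebesgue_point_def)
    have "((\<lambda>i. lam i * (?w i x * ?w i x) + lam i * (?w i y * ?w i y)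
          + (-2) * (lam i * (?w i x * ?w i y)))
        has_sum T_kernel \<mu> x x + T_kernel \<mu> y y + (-2) * T_kernel \<mu> x y) I"
      by (intro has_sum_add has_sum_cmult_right expansion that)
    then show ?thesis
      unfolding dist_square_eq_T_kernel by (simp add: power2_eq_square algebra_simps)
  qed
  ultimately show ?thesis
    by (auto elim!: eventually_mono)
qed

end
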